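(* If a class $\mathscr{C}$ of hypergraphs has the bounded multi-intersection property (BMIP), then it has bounded VC-dimension. However, there exist classes $\mathscr{C}$ of hypergraphs with bounded VC-dimension that do not have the BMIP.
   Context: A hypergraph $H=(V(H),E(H))$ consists of a finite set $V(H)$ of vertices and a set $E(H)$ of non-empty subsets of $V(H)$ (edges), such that every vertex lies in at least one edge. The $c$-multi-intersection width $c\text{-miwidth}(H)$ is the maximum cardinality of an intersection $e_1\cap\dots\cap e_c$ of $c$ distinct edges of $H$. A class $\mathscr{C}$ has the BMIP if there exist constants $c\ge 1$ and $i\ge 0$ such that $c\text{-miwidth}(H)\le i$ for every $H\in\mathscr{C}$ (the condition is void for $H$ with fewer than $c$ edges). A set $X\subseteq V(H)$ is shattered if $\{X\cap e: e\in E(H)\}=2^X$; the VC-dimension of $H$ is the maximum cardinality of a shattered subset of $V(H)$. A class has bounded VC-dimension if there is a constant $d$ such that every hypergraph in the class has VC-dimension at most $d$. *)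

theory Defs
  imports Complex_Main
begin

record 'a hypergraph =
  verts :: "'a set"
  edges :: "'a set set"

definition is_hypergraph :: "'a hypergraph \<Rightarrow> bool" where
  "is_hypergraph H \<longleftrightarrow>
     finite (verts H) \<and>
     (\<forall>e\<in>edges H. e \<noteq> {} \<and> e \<subseteq> verts H) \<and>
     (\<forall>v\<in>verts H. \<exists>e\<in>edges H. v \<in> e)"

text \<open>
  Both maxima below are suprema in \<^typ>\<open>nat\<close>: on a non-empty finite set this is the maximum,
  and the supremum of the empty set is 0. Hence \<open>miwidth c H\<close> is 0 if \<open>H\<close> has fewer
  than \<open>c\<close> edges, and \<open>vc_dim H\<close> is 0 if \<open>H\<close> has no edges (in which case not even
  the empty set is shattered). The width is only meaningful for \<open>c \<ge> 1\<close>.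
\<close>

definition miwidth :: "nat \<Rightarrow> 'a hypergraph \<Rightarrow> nat" where
  "miwidth c H = Sup {card (\<Inter>F) | F. F \<subseteq> edges H \<and> card F = c}"

definition BMIP :: "'a hypergraph set \<Rightarrow> bool" where
  "BMIP \<C> \<longleftrightarrow> (\<exists>c\<ge>1. \<exists>i. \<forall>H\<in>\<C>. miwidth c H \<le> i)"

definition shattered :: "'a hypergraph \<Rightarrow> 'a set \<Rightarrow> bool" where
  "shattered H X \<longleftrightarrow> X \<subseteq> verts H \<and> {X \<inter> e | e. e \<in> edges H} = Pow X"

definition vc_dim :: "'a hypergraph \<Rightarrow> nat" where
  "vc_dim H = Sup {card X | X. shattered H X}"

definition bounded_vc_dim :: "'a hypergraph set \<Rightarrow> bool" where
  "bounded_vc_dim \<C> \<longleftrightarrow> (\<exists>d. \<forall>H\<in>\<C>. vc_dim H \<le> d)"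

end

theory Submission
  imports Defs
begin

text \<open>
  If \<open>X\<close> is shattered, then each of its complements \<open>X - {x}\<close> is the trace of an edge;
  choosing \<open>c\<close> points of \<open>X\<close> gives \<open>c\<close> distinct edges with at least \<open>|X| - c\<close> common points.
  On the other hand, initial segments of the natural numbers form a chain, which shatters no
  two-element set but contains arbitrarily many edges with a large intersection.
\<close>

text \<open>\<open>cSup_least\<close> needs a non-empty set. If nothing is shattered, the supremum
  takes its default value 0.\<close>

lemma vc_dim_le:
  assumes "\<And>X. shattered H X \<Longrightarrow> card X \<le> d"
  shows "vc_dim H \<le> d"
proof (cases "\<exists>X. shattered H X")
  case True
  then show ?thesis
    unfolding vc_dim_def by (intro cSup_least) (auto intro: assms)
next
  case False
  then show ?thesis
    by (simp add: vc_dim_def)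
qed

text \<open>A \<open>Sup\<close> in nat dominates the members only of a bounded set. The bound here
  comes from the finite vertex set, which contains every intersection considered.\<close>

lemma card_Inter_le_miwidth:
  assumes H: "is_hypergraph H" and F: "F \<subseteq> edges H" "F \<noteq> {}"
  shows "card (\<Inter>F) \<le> miwidth (card F) H"
proof -
  have fin: "finite (verts H)" and sub: "\<And>e. e \<in> edges H \<Longrightarrow> e \<subseteq> verts H"
    using H by (auto simp: is_hypergraph_def)
  have "finite (edges H)"
    using fin sub by (meson PowI finite_Pow_iff finite_subset subsetI)
  \<comment> \<open>This makes every competing family \<open>G\<close> of the same size non-empty;
    otherwise \<open>\<Inter>G\<close> would be \<open>UNIV\<close>.\<close>
  then have "0 < card F"
    using F finite_subset by (auto simp: card_gt_0_iff)
  have "card (\<Inter>G) \<le> card (verts H)" if G: "G \<subseteq> edges H" "card G = card F" for G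
  proof (intro card_mono fin)
    obtain e where "e \<in> G"
      using G(2) \<open>0 < card F\<close> by fastforce
    then show "\<Inter>G \<subseteq> verts H"
      using G(1) sub by blast
  qed
  then have "bdd_above {card (\<Inter>G) | G. G \<subseteq> edges H \<and> card G = card F}"
    by (intro bdd_aboveI) auto
  then show ?thesis
    unfolding miwidth_def using F by (intro cSup_upper) auto
qed

text \<open>The summand \<open>c\<close> pays for the chosen points, each missed by one of the
  edges, and also covers sets \<open>X\<close> with at most \<open>c\<close> points.\<close>

lemma card_shattered_le:
  assumes H: "is_hypergraph H" and X: "shattered H X" and c: "1 \<le> c"
  shows "card X \<le> c + miwidth c H"
proof (cases "card X \<le> c")
  case False
  \<comment> \<open>An infinite set has \<open>card\<close> 0, which cannot exceed
    \<open>c\<close>.\<close>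
  have "finite X"
    using False card.infinite by fastforce
  obtain Y where Y: "Y \<subseteq> X" "card Y = c"
    using False by (meson nat_le_linear obtain_subset_with_card_n)
  have "\<exists>e\<in>edges H. X \<inter> e = X - {x}" for x
  proof -
    have "X - {x} \<in> {X \<inter> e | e. e \<in> edges H}"
      using X by (auto simp: shattered_def)
    then show ?thesis
      by auto
  qed
  then obtain f where f: "\<And>x. f x \<in> edges H" "\<And>x. X \<inter> f x = X - {x}"
    by metis
  \<comment> \<open>The edge \<open>f y\<close> misses exactly one point of \<open>X\<close>, namely
    \<open>y\<close>, so it determines \<open>y\<close>.\<close>
  have "inj_on f Y"
    using f(2) Y(1) by (intro inj_onI) blast
  then have card: "card (f ` Y) = c"
    using Y(2) by (simp add: card_image)
  have "f ` Y \<noteq> {}"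
    using card c by force
  moreover have "f ` Y \<subseteq> edges H"
    using f(1) by blast
  ultimately have width: "card (\<Inter>(f ` Y)) \<le> miwidth c H"
    using card_Inter_le_miwidth[OF H] card by metis
  \<comment> \<open>\<open>card_mono\<close> requires the larger set to be finite. As
    \<open>Y\<close> is non-empty, the intersection lies inside a finite edge.\<close>
  have "finite (\<Inter>(f ` Y))"
  proof -
    obtain y where "y \<in> Y"
      using \<open>f ` Y \<noteq> {}\<close> by blast
    moreover have "finite (f y)"
      using H f(1) by (meson finite_subset is_hypergraph_def)
    ultimately show ?thesis
      by blast
  qed
  moreover have "X - Y \<subseteq> \<Inter>(f ` Y)"
    using f(2) by blast
  ultimately have "card (X - Y) \<le> card (\<Inter>(f ` Y))"
    by (rule card_mono)
  moreover have "card (X - Y) = card X - c"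
    using Y \<open>finite X\<close> by (simp add: card_Diff_subset finite_subset)
  ultimately show ?thesis
    using width by linarith
qed simp

lemma BMIP_imp_bounded_vc_dim:
  assumes "\<And>H. H \<in> \<C> \<Longrightarrow> is_hypergraph H" and "BMIP \<C>"
  shows "bounded_vc_dim \<C>"
proof -
  obtain c i where c: "1 \<le> c" and i: "\<And>H. H \<in> \<C> \<Longrightarrow> miwidth c H \<le> i"
    using assms(2) by (auto simp: BMIP_def)
  have "vc_dim H \<le> c + i" if "H \<in> \<C>" for H
  proof (rule vc_dim_le)
    fix X assume "shattered H X"
    then show "card X \<le> c + i"
      using card_shattered_le[of H X c] assms(1) c i that by fastforce
  qed
  then show ?thesis
    unfolding bounded_vc_dim_def by blast
qed

definition chain_hypergraph :: "nat \<Rightarrow> nat hypergraph" where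
  "chain_hypergraph n = \<lparr>verts = {..n}, edges = atMost ` {..n}\<rparr>"

lemma is_hypergraph_chain: "is_hypergraph (chain_hypergraph n)"
  by (auto simp: is_hypergraph_def chain_hypergraph_def)

lemma vc_dim_chain_le: "vc_dim (chain_hypergraph n) \<le> 1"
proof (rule vc_dim_le)
  fix X assume X: "shattered (chain_hypergraph n) X"
  have "finite X"
    using X finite_subset by (auto simp: shattered_def chain_hypergraph_def)
  have no_less: False if "x \<in> X" "y \<in> X" "x < y" for x y
  proof -
    \<comment> \<open>This trace is impossible: an initial segment containing \<open>y\<close> also
      contains the smaller \<open>x\<close>.\<close>
    have "{y} \<in> {X \<inter> e | e. e \<in> edges (chain_hypergraph n)}"
      using X that by (auto simp: shattered_def)
    then obtain m where "{y} = X \<inter> {..m}"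
      by (auto simp: chain_hypergraph_def)
    then have "y \<le> m" "x \<notin> {..m}"
      using that by auto
    then show False
      using that by simp
  qed
  have "\<forall>x\<in>X. \<forall>y\<in>X. x = y"
    using no_less by (meson linorder_neqE_nat)
  then show "card X \<le> 1"
    using \<open>finite X\<close> by (simp add: card_le_Suc0_iff_eq)
qed

lemma miwidth_chain_gt:
  assumes "1 \<le> c"
  shows "i < miwidth c (chain_hypergraph (i + c))"
proof -
  \<comment> \<open>As \<open>c\<close> is positive, the smallest of these nested segments is
    \<open>{..i}\<close>. It has \<open>i + 1\<close> elements, hence the strict inequality.\<close>
  let ?F = "atMost ` {i..<i + c}"
  have "card ?F = c"
    by (simp add: card_image inj_on_def)
  moreover have "\<Inter>?F = {..i}"
    using assms by fastforce
  moreover have "card (\<Inter>?F) \<le> miwidth (card ?F) (chain_hypergraph (i + c))"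
    using assms
    by (intro card_Inter_le_miwidth is_hypergraph_chain) (auto simp: chain_hypergraph_def)
  ultimately show ?thesis
    by simp
qed

theorem lemma7p9:
  shows "(\<forall>\<C> :: 'a hypergraph set.
            (\<forall>H\<in>\<C>. is_hypergraph H) \<longrightarrow> BMIP \<C> \<longrightarrow> bounded_vc_dim \<C>) \<and>
         (\<exists>\<C> :: nat hypergraph set.
            (\<forall>H\<in>\<C>. is_hypergraph H) \<and> bounded_vc_dim \<C> \<and> \<not> BMIP \<C>)"
proof (intro conjI allI impI exI)
  show "bounded_vc_dim \<C>" if "\<forall>H\<in>\<C>. is_hypergraph H" "BMIP \<C>" for \<C> :: "'a hypergraph set"
    using that BMIP_imp_bounded_vc_dim by blast
  show "\<forall>H\<in>range chain_hypergraph. is_hypergraph H"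
    using is_hypergraph_chain by blast
  show "bounded_vc_dim (range chain_hypergraph)"
    unfolding bounded_vc_dim_def using vc_dim_chain_le by blast
  \<comment> \<open>Given candidate constants \<open>c\<close> and \<open>i\<close>, the member with
    index \<open>i + c\<close> violates the bound.\<close>
  show "\<not> BMIP (range chain_hypergraph)"
    unfolding BMIP_def using miwidth_chain_gt by (meson leD rangeI)
qed

end
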